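(* Suppose that $F$ is an outer function in $QA$ and $I$ is an inner function. Then $IF$ is $G$-extremal if and only if there exists a sequence $\{z_n\}\subset\mathbb D$ such that $|F(z_n)|\to\|F\|_\infty$ and $I(z_n)\to0$.
   Context: $\mathbb D=\{z\in\mathbb C:|z|<1\}$, $\mathbb T=\partial\mathbb D$, $m$ is normalized arc length measure on $\mathbb T$, $L^p=L^p(\mathbb T,m)$. For $f\in L^1$, the Poisson integral is $\mathcal Pf(z)=\int_{\mathbb T}f(\zeta)\frac{1-|z|^2}{|\zeta-z|^2}\,dm(\zeta)$, $z\in\mathbb D$. $H^\infty$ is the set of $f\in L^\infty$ with $\mathcal Pf$ analytic on $\mathbb D$; such $f$ is identified with its analytic extension $\mathcal Pf$. For $f\in L^2$ put $\Phi_f(z)=\mathcal P(|f|^2)(z)-|\mathcal Pf(z)|^2$, $z\in\mathbb D$, and $\|f\|_G=\sup_{z\in\mathbb D}\Phi_f(z)^{1/2}$ (the Garsia norm). $\mathrm{BMO}$ is the set of $f\in L^2$ with $\|f\|_G<\infty$; $\mathrm{VMO}$ is the set of $f\in\mathrm{BMO}$ with $\Phi_f(z)\to0$ as $|z|\to1^-$; $QA=\mathrm{VMO}\cap H^\infty$. A function $f\in L^\infty$ is called $G$-extremal if $\|f\|_G=\|f\|_\infty$. An inner function is a function $I\in H^\infty$ with $|I|=1$ a.e. on $\mathbb T$. An analytic function $F$ on $\mathbb D$ is outer if it is zero-free and $\log|F(z)|$ is the Poisson integral of an $L^1$ function on $\mathbb T$. *)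

theory Defs
  imports "HOL-Complex_Analysis.Complex_Analysis" "HOL-Probability.Essential_Supremum"
begin

text \<open>
  Elements of $L^p$ are represented by Borel functions on the unit circle. The definitions below
  only depend on the class of a function modulo equality almost everywhere.
\<close>

definition circle_measure :: "complex measure" where
  "circle_measure =
     distr (uniform_measure lborel {0..2*pi}) (restrict_space borel (sphere 0 1)) cis"

text \<open>
  \<^const>\<open>distr\<close> may degenerate to the null measure for non-measurable maps; the following two facts
  record that this does not happen here.
\<close>

lemma cis_measurable_sphere:
  "cis \<in> measurable (uniform_measure lborel {0..2*pi}) (restrict_space borel (sphere 0 1))"
proof -
  have "cis \<in> borel_measurable borel"
    by (intro borel_measurable_continuous_onI continuous_intros)
  then have "cis \<in> borel_measurable (uniform_measure lborel {0..2*pi})"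
    by simp
  then show ?thesis
    by (intro measurable_restrict_space2) auto
qed

lemma emeasure_circle_measure: "emeasure circle_measure (sphere 0 1) = 1"
proof -
  have vimage: "cis -` sphere 0 1 = UNIV"
    by auto
  have "emeasure circle_measure (sphere 0 1) = emeasure (uniform_measure lborel {0..2*pi}) UNIV"
    unfolding circle_measure_def
    by (subst emeasure_distr[OF cis_measurable_sphere])
       (auto simp: sets_restrict_space_iff vimage)
  also have "\<dots> = 1"
    by (subst emeasure_uniform_measure) (auto simp: ennreal_divide_self)
  finally show ?thesis .
qed

definition poisson :: "(complex \<Rightarrow> 'a::{banach, second_countable_topology}) \<Rightarrow> complex \<Rightarrow> 'a" where
  "poisson f z =
     (\<integral>\<zeta>. ((1 - (norm z)\<^sup>2) / (norm (\<zeta> - z))\<^sup>2) *\<^sub>R f \<zeta> \<partial>circle_measure)"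

definition L2 :: "(complex \<Rightarrow> complex) set" where
  "L2 = {f \<in> borel_measurable circle_measure.
           integrable circle_measure (\<lambda>\<zeta>. (norm (f \<zeta>))\<^sup>2)}"

definition linf_norm :: "(complex \<Rightarrow> complex) \<Rightarrow> ennreal" where
  "linf_norm f = esssup circle_measure (\<lambda>\<zeta>. ennreal (norm (f \<zeta>)))"

definition Linf :: "(complex \<Rightarrow> complex) set" where
  "Linf = {f \<in> borel_measurable circle_measure. linf_norm f < \<infinity>}"

definition Hinf :: "(complex \<Rightarrow> complex) set" where
  "Hinf = {f \<in> Linf. poisson f analytic_on ball 0 1}"

definition garsia_Phi :: "(complex \<Rightarrow> complex) \<Rightarrow> complex \<Rightarrow> real" where
  "garsia_Phi f z = poisson (\<lambda>\<zeta>. (norm (f \<zeta>))\<^sup>2) z - (norm (poisson f z))\<^sup>2"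

definition garsia_norm :: "(complex \<Rightarrow> complex) \<Rightarrow> ennreal" where
  "garsia_norm f = (SUP z\<in>ball 0 1. ennreal (sqrt (garsia_Phi f z)))"

definition BMO :: "(complex \<Rightarrow> complex) set" where
  "BMO = {f \<in> L2. garsia_norm f < \<infinity>}"

text \<open>The filter below expresses $|z| \to 1^-$, uniformly in the argument of $z$.\<close>

definition VMO :: "(complex \<Rightarrow> complex) set" where
  "VMO = {f \<in> BMO. (garsia_Phi f \<longlongrightarrow> 0) (filtercomap norm (at_left 1))}"

definition QA :: "(complex \<Rightarrow> complex) set" where
  "QA = VMO \<inter> Hinf"

definition G_extremal :: "(complex \<Rightarrow> complex) \<Rightarrow> bool" where
  "G_extremal f \<longleftrightarrow> f \<in> Linf \<and> garsia_norm f = linf_norm f"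

definition inner_function :: "(complex \<Rightarrow> complex) \<Rightarrow> bool" where
  "inner_function f \<longleftrightarrow> f \<in> Hinf \<and> (AE \<zeta> in circle_measure. norm (f \<zeta>) = 1)"

text \<open>
  Unlike inner functions, which are given by their boundary values, the argument here is a
  function on the disc; a boundary function \<open>f\<close> in \<^const>\<open>Hinf\<close> is outer if
  \<open>outer_function (poisson f)\<close> holds.
\<close>

definition outer_function :: "(complex \<Rightarrow> complex) \<Rightarrow> bool" where
  "outer_function g \<longleftrightarrow> g analytic_on ball 0 1 \<and> (\<forall>z\<in>ball 0 1. g z \<noteq> 0) \<and>
     (\<exists>u :: complex \<Rightarrow> real. integrable circle_measure u \<and>
        (\<forall>z\<in>ball 0 1. ln (norm (g z)) = poisson u z))"

end

theory Submission
  imports Defs "HOL-Probability.Probability_Measure"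
begin

text \<open>
  For \<open>z\<close> in the disc, the Poisson kernel turns arc length into a probability measure \<open>Q\<^sub>z\<close>,
  the harmonic measure. Then \<open>\<P>f(z)\<close> is the mean of \<open>f\<close> under \<open>Q\<^sub>z\<close> and \<open>\<Phi>\<^sub>f(z)\<close> its variance.
  Write \<open>M = \<parallel>F\<parallel>\<^sub>\<infinity> = \<parallel>IF\<parallel>\<^sub>\<infinity>\<close>. Since \<open>|IF| = |F|\<close> almost everywhere,
  \<open>\<Phi>\<^bsub>IF\<^esub> = \<P>(|F|\<^sup>2) - |\<P>(IF)|\<^sup>2 \<le> M\<^sup>2\<close>, so \<open>IF\<close> is \<open>G\<close>-extremal precisely when
  \<open>\<Phi>\<^bsub>IF\<^esub>(z\<^sub>n) \<rightarrow> M\<^sup>2\<close> for some sequence (\<open>garsia_norm_eq_iff_sequence\<close>). It is shown that one and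
  the same sequence satisfies this condition if and only if \<open>|F(z\<^sub>n)| \<rightarrow> M\<close> and \<open>I(z\<^sub>n) \<rightarrow> 0\<close>.

  The link between the two conditions is the covariance of \<open>I\<close> and \<open>F\<close> under \<open>Q\<^sub>z\<close>: as \<open>|I| \<le> 1\<close>, the
  Cauchy--Schwarz inequality gives \<open>|\<P>(IF)(z) - I(z) F(z)| \<le> \<Phi>\<^sub>F(z)\<^bsup>1/2\<^esup>\<close>
  (\<open>norm_poisson_mult_diff_le\<close>). Hence \<open>\<P>(IF)(z\<^sub>n) - I(z\<^sub>n) F(z\<^sub>n) \<rightarrow> 0\<close> along any sequence with
  \<open>\<Phi>\<^sub>F(z\<^sub>n) \<rightarrow> 0\<close>. If \<open>|F(z\<^sub>n)| \<rightarrow> M\<close>, then \<open>\<Phi>\<^sub>F(z\<^sub>n) \<le> M\<^sup>2 - |F(z\<^sub>n)|\<^sup>2 \<rightarrow> 0\<close> and \<open>\<P>(|F|\<^sup>2)(z\<^sub>n) \<rightarrow> M\<^sup>2\<close>;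
  if also \<open>I(z\<^sub>n) \<rightarrow> 0\<close>, then \<open>\<P>(IF)(z\<^sub>n) \<rightarrow> 0\<close> and \<open>\<Phi>\<^bsub>IF\<^esub>(z\<^sub>n) \<rightarrow> M\<^sup>2\<close>.

  Conversely, \<open>\<Phi>\<^bsub>IF\<^esub>(z\<^sub>n) \<rightarrow> M\<^sup>2\<close> forces \<open>\<P>(|F|\<^sup>2)(z\<^sub>n) \<rightarrow> M\<^sup>2\<close> and \<open>\<P>(IF)(z\<^sub>n) \<rightarrow> 0\<close>. Once
  \<open>\<Phi>\<^sub>F(z\<^sub>n) \<rightarrow> 0\<close> is known (\<open>garsia_Phi_tendsto_zero_if_power2_tendsto\<close>), it follows that \<open>|F(z\<^sub>n)| \<rightarrow> M\<close> and
  \<open>I(z\<^sub>n) F(z\<^sub>n) \<rightarrow> 0\<close>, so \<open>I(z\<^sub>n) \<rightarrow> 0\<close>. If \<open>M\<^sup>2 - |F|\<^sup>2\<close> has positive integral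
  over the circle, Harnack's inequality shows that \<open>\<P>(|F|\<^sup>2)\<close> can approach \<open>M\<^sup>2\<close> only as \<open>|z\<^sub>n| \<rightarrow> 1\<close>, and
  the vanishing mean oscillation of \<open>F\<close> applies. If the integral is zero, then \<open>|F| = M\<close> almost
  everywhere, so \<open>\<Phi>\<^sub>F = M\<^sup>2 - |\<P>F|\<^sup>2\<close>, and vanishing mean oscillation says that \<open>|\<P>F(z)| \<rightarrow> M\<close> uniformly
  as \<open>|z| \<rightarrow> 1\<close>. The maximum principle for the analytic function \<open>1/\<P>F\<close> then gives \<open>|\<P>F| \<ge> M\<close> on the
  disc, that is, \<open>\<Phi>\<^sub>F = 0\<close>.
\<close>

section \<open>Moments of bounded random variables\<close>

lemma (in prob_space) expectation_le_sqrt_second_moment: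
  fixes g :: "'a \<Rightarrow> real"
  assumes "integrable M g" "integrable M (\<lambda>x. (g x)\<^sup>2)"
  shows "expectation g \<le> sqrt (expectation (\<lambda>x. (g x)\<^sup>2))"
  using variance_eq[OF assms] variance_positive[of g] by (intro real_le_rsqrt) simp

lemma (in prob_space) integrable_bounded_power2:
  fixes f :: "'a \<Rightarrow> complex"
  assumes [measurable]: "f \<in> borel_measurable M" and "AE x in M. norm (f x) \<le> B"
  shows "integrable M (\<lambda>x. (norm (f x))\<^sup>2)"
proof (rule integrable_const_bound[where B = "B\<^sup>2"])
  show "AE x in M. norm ((norm (f x))\<^sup>2) \<le> B\<^sup>2"
    using assms(2) by eventually_elim (auto intro!: power_mono)
qed simp

lemma (in prob_space) complex_variance_eq:
  fixes f :: "'a \<Rightarrow> complex"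
  assumes [measurable]: "f \<in> borel_measurable M" and bound: "AE x in M. norm (f x) \<le> B"
  shows "expectation (\<lambda>x. (norm (f x - integral\<^sup>L M f))\<^sup>2)
           = expectation (\<lambda>x. (norm (f x))\<^sup>2) - (norm (integral\<^sup>L M f))\<^sup>2"
proof -
  define c where "c = integral\<^sup>L M f"
  have f: "integrable M f"
    by (rule integrable_const_bound[OF bound]) simp
  have f2: "integrable M (\<lambda>x. (norm (f x))\<^sup>2)"
    by (rule integrable_bounded_power2[OF _ bound]) simp
  define R where "R = (\<lambda>x. Re (cnj c * f x))"
  have "(norm (f x - c))\<^sup>2 = (norm (f x))\<^sup>2 - 2 * R x + (norm c)\<^sup>2" for x
    unfolding R_def by (simp only: cmod_power2) (simp add: power2_eq_square algebra_simps)
  moreover have "integrable M R"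
    unfolding R_def using f by (intro integrable_Re integrable_mult_right)
  moreover have "expectation R = (norm c)\<^sup>2"
  proof -
    have "expectation R = Re (integral\<^sup>L M (\<lambda>x. cnj c * f x))"
      unfolding R_def using f by (intro integral_Re) simp
    also have "\<dots> = Re (cnj c * c)"
      using f by (simp add: c_def)
    finally show ?thesis
      by (simp only: cmod_power2) (simp add: power2_eq_square)
  qed
  ultimately show ?thesis
    unfolding c_def[symmetric] using f2 by (simp add: prob_space)
qed

text \<open>
  The left-hand side is \<open>|E(u (f - E f))|\<close>, and the first absolute moment of \<open>f - E f\<close> is at most its
  standard deviation.
\<close>

lemma (in prob_space) norm_expectation_mult_diff_le:
  fixes u f :: "'a \<Rightarrow> complex"
  assumes [measurable]: "u \<in> borel_measurable M" "f \<in> borel_measurable M"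
    and u: "AE x in M. norm (u x) \<le> 1" and bound: "AE x in M. norm (f x) \<le> B"
  shows "norm (integral\<^sup>L M (\<lambda>x. u x * f x) - integral\<^sup>L M u * integral\<^sup>L M f)
           \<le> sqrt (expectation (\<lambda>x. (norm (f x))\<^sup>2) - (norm (integral\<^sup>L M f))\<^sup>2)"
proof -
  define c where "c = integral\<^sup>L M f"
  have bound_c: "AE x in M. norm (f x - c) \<le> B + norm c"
    using bound by eventually_elim (metis add_right_mono norm_triangle_ineq4 order_trans)
  have "AE x in M. norm (u x * f x) \<le> B"
    using u bound
  proof eventually_elim
    case (elim x)
    have "norm (u x) * norm (f x) \<le> 1 * norm (f x)"
      using elim by (intro mult_right_mono) auto
    then show ?case
      using elim by (simp add: norm_mult)
  qed
  then have uf: "integrable M (\<lambda>x. u x * f x)"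
    by (rule integrable_const_bound) simp
  have iu: "integrable M u"
    by (rule integrable_const_bound[OF u]) simp
  have fc: "integrable M (\<lambda>x. norm (f x - c))"
    using bound_c by (intro integrable_norm integrable_const_bound) auto
  have "norm (integral\<^sup>L M (\<lambda>x. u x * f x) - integral\<^sup>L M u * c)
          = norm (integral\<^sup>L M (\<lambda>x. u x * f x - u x * c))"
    using uf iu by simp
  also have "\<dots> \<le> expectation (\<lambda>x. norm (u x * f x - u x * c))"
    by (rule integral_norm_bound)
  also have "\<dots> \<le> expectation (\<lambda>x. norm (f x - c))"
  proof (rule integral_mono_AE[OF _ fc])
    show "AE x in M. norm (u x * f x - u x * c) \<le> norm (f x - c)"
      using u
    proof eventually_elim
      case (elim x)
      have "norm (u x) * norm (f x - c) \<le> 1 * norm (f x - c)"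
        using elim by (intro mult_right_mono) auto
      then show ?case
        by (simp add: norm_mult flip: right_diff_distrib)
    qed
  qed (use uf iu in auto)
  also have "\<dots> \<le> sqrt (expectation (\<lambda>x. (norm (f x - c))\<^sup>2))"
    by (intro expectation_le_sqrt_second_moment fc integrable_bounded_power2[OF _ bound_c]) simp
  finally show ?thesis
    using complex_variance_eq[OF assms(2) bound] by (simp add: c_def)
qed

section \<open>The Poisson kernel and harmonic measure\<close>

definition poisson_kernel :: "complex \<Rightarrow> complex \<Rightarrow> real" where
  "poisson_kernel z \<zeta> = (1 - (norm z)\<^sup>2) / (norm (\<zeta> - z))\<^sup>2"

definition harmonic_measure :: "complex \<Rightarrow> complex measure" where
  "harmonic_measure z = density circle_measure (\<lambda>\<zeta>. ennreal (poisson_kernel z \<zeta>))"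

lemma sets_circle_measure [measurable_cong]:
  "sets circle_measure = sets (restrict_space borel (sphere 0 1))"
  by (simp add: circle_measure_def)

lemma space_circle_measure: "space circle_measure = sphere 0 1"
  by (simp add: circle_measure_def space_restrict_space)

interpretation circle: prob_space circle_measure
  by (rule prob_spaceI) (simp add: space_circle_measure emeasure_circle_measure)

lemma sets_harmonic_measure [measurable_cong]: "sets (harmonic_measure z) = sets circle_measure"
  by (simp add: harmonic_measure_def)

lemma measurable_poisson_kernel [measurable]:
  "poisson_kernel z \<in> borel_measurable circle_measure"
  unfolding poisson_kernel_def measurable_cong_sets[OF sets_circle_measure refl]
  by (intro measurable_restrict_space1) measurable

lemma poisson_kernel_nonneg: "z \<in> ball 0 1 \<Longrightarrow> 0 \<le> poisson_kernel z \<zeta>"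
  by (auto simp: poisson_kernel_def power_le_one intro!: divide_nonneg_nonneg)

text \<open>
  On the unit circle \<open>1/\<zeta>\<close> is the conjugate of \<open>\<zeta>\<close>, which turns the kernel into \<open>\<zeta> h(\<zeta>) / (\<zeta> - z)\<close>
  with \<open>h(w) = (1 - |z|\<^sup>2) / (1 - cnj z w)\<close> holomorphic near the closed disc. As \<open>h(z) = 1\<close>, the total
  mass is an instance of Cauchy's integral formula.
\<close>

lemma has_integral_poisson_kernel:
  assumes z: "z \<in> ball 0 1"
  shows "((\<lambda>t. poisson_kernel z (cis t)) has_integral 2 * pi) {0..2*pi}"
proof -
  define h where "h = (\<lambda>w. (1 - (norm z)\<^sup>2) / (1 - cnj z * w))"
  have ne: "1 - cnj z * w \<noteq> 0" if "norm w \<le> 1" for w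
  proof
    assume "1 - cnj z * w = 0"
    then have "norm z * norm w = 1"
      by (metis complex_mod_cnj eq_iff_diff_eq_0 norm_mult norm_one)
    moreover have "norm z * norm w \<le> norm z * 1"
      using that by (intro mult_left_mono) auto
    ultimately show False
      using z by simp
  qed
  have "((\<lambda>w. h w / (w - z)) has_contour_integral 2 * of_real pi * \<i> * h z) (circlepath 0 1)"
  proof (rule Cauchy_integral_circlepath)
    show "continuous_on (cball 0 1) h"
      unfolding h_def using ne by (intro continuous_intros) auto
    show "h holomorphic_on ball 0 1"
      unfolding h_def using ne by (intro holomorphic_intros) auto
    show "norm (z - 0) < 1"
      using z by simp
  qed
  moreover have "h z = 1"
    using ne[of z] z unfolding h_def
    by (simp add: mult.commute flip: complex_norm_square)
  ultimately have "((\<lambda>t. h (cis t) / (cis t - z) * \<i> * cis t) has_integral 2 * pi * \<i>) {0..2*pi}"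
    unfolding circlepath_def
    by (subst (asm) has_contour_integral_part_circlepath_iff) auto
  moreover have "h (cis t) / (cis t - z) * \<i> * cis t = \<i> * of_real (poisson_kernel z (cis t))" for t
  proof -
    have cz: "cis t - z \<noteq> 0"
      using z by (metis eq_iff_diff_eq_0 mem_ball_0 norm_cis less_irrefl)
    have c: "cis t * cnj (cis t - z) = 1 - cnj z * cis t"
      by (simp add: algebra_simps cis_cnj cis_mult)
    have "of_real ((norm (cis t - z))\<^sup>2) = (cis t - z) * cnj (cis t - z)"
      by (rule complex_norm_square)
    then have "of_real (poisson_kernel z (cis t))
        = of_real (1 - (norm z)\<^sup>2) / ((cis t - z) * cnj (cis t - z))"
      unfolding poisson_kernel_def by (simp only: of_real_divide)
    also have "\<dots> = of_real (1 - (norm z)\<^sup>2) * cis t / ((cis t - z) * (cis t * cnj (cis t - z)))"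
      using cz by (simp add: divide_simps)
    finally show ?thesis
      unfolding c h_def by (simp add: mult_ac)
  qed
  ultimately have "((\<lambda>t. \<i> * of_real (poisson_kernel z (cis t))) has_integral 2 * pi * \<i>) {0..2*pi}"
    by simp
  from has_integral_mult_right[OF this, of "- \<i>"]
  have "((\<lambda>t. complex_of_real (poisson_kernel z (cis t))) has_integral of_real (2 * pi)) {0..2*pi}"
    by (simp add: algebra_simps)
  from has_integral_linear[OF this bounded_linear_Re] show ?thesis
    by (simp add: o_def)
qed

lemma prob_space_harmonic_measure:
  assumes z: "z \<in> ball 0 1"
  shows "prob_space (harmonic_measure z)"
proof (rule prob_spaceI)
  have meas: "(\<lambda>t. poisson_kernel z (cis t)) \<in> borel_measurable borel"
    unfolding poisson_kernel_def
    by (intro borel_measurable_divide borel_measurable_power borel_measurable_norm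
          borel_measurable_diff borel_measurable_const borel_measurable_continuous_onI continuous_intros)
  have "emeasure (harmonic_measure z) (space (harmonic_measure z))
          = (\<integral>\<^sup>+\<zeta>. ennreal (poisson_kernel z \<zeta>) \<partial>circle_measure)"
    by (simp add: harmonic_measure_def emeasure_density)
  also have "\<dots> = (\<integral>\<^sup>+t. ennreal (poisson_kernel z (cis t)) \<partial>uniform_measure lborel {0..2*pi})"
    unfolding circle_measure_def
    using measurable_poisson_kernel[of z, unfolded measurable_cong_sets[OF sets_circle_measure refl]]
    by (intro nn_integral_distr cis_measurable_sphere) simp
  also have "\<dots> = (\<integral>\<^sup>+t. ennreal (poisson_kernel z (cis t)) * indicator {0..2*pi} t \<partial>lborel)
                    / emeasure lborel {0..2*pi}"
    using meas by (intro nn_integral_uniform_measure) auto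
  also have "(\<integral>\<^sup>+t. ennreal (poisson_kernel z (cis t)) * indicator {0..2*pi} t \<partial>lborel)
               = ennreal (2 * pi)"
    by (intro nn_integral_has_integral_lebesgue' poisson_kernel_nonneg z has_integral_poisson_kernel)
  finally show "emeasure (harmonic_measure z) (space (harmonic_measure z)) = 1"
    by (simp add: ennreal_divide_self)
qed

lemma poisson_eq_harmonic_integral:
  assumes "f \<in> borel_measurable circle_measure" "z \<in> ball 0 1"
  shows "poisson f z = integral\<^sup>L (harmonic_measure z) f"
  unfolding harmonic_measure_def poisson_def poisson_kernel_def[symmetric]
  using assms poisson_kernel_nonneg[OF assms(2)]
  by (subst integral_density) auto

lemma AE_harmonic_measure:
  assumes "AE \<zeta> in circle_measure. P \<zeta>"
  shows "AE \<zeta> in harmonic_measure z. P \<zeta>"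
  unfolding harmonic_measure_def using assms by (subst AE_density) auto

section \<open>Poisson integrals and the Garsia variance\<close>

context
  fixes f :: "complex \<Rightarrow> complex" and M :: real
  assumes meas [measurable]: "f \<in> borel_measurable circle_measure"
    and bound: "AE \<zeta> in circle_measure. norm (f \<zeta>) \<le> M"
begin

lemma poisson_power2_le:
  assumes z: "z \<in> ball 0 1"
  shows "poisson (\<lambda>\<zeta>. (norm (f \<zeta>))\<^sup>2) z \<le> M\<^sup>2"
proof -
  interpret Q: prob_space "harmonic_measure z"
    by (rule prob_space_harmonic_measure[OF z])
  have "Q.expectation (\<lambda>\<zeta>. (norm (f \<zeta>))\<^sup>2) \<le> Q.expectation (\<lambda>_. M\<^sup>2)"
  proof (rule integral_mono_AE)
    show "AE \<zeta> in harmonic_measure z. (norm (f \<zeta>))\<^sup>2 \<le> M\<^sup>2"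
      using AE_harmonic_measure[OF bound] by eventually_elim (auto intro!: power_mono)
  qed (use AE_harmonic_measure[OF bound] in \<open>auto intro!: Q.integrable_bounded_power2\<close>)
  then show ?thesis
    using z by (simp add: poisson_eq_harmonic_integral Q.prob_space)
qed

lemma garsia_Phi_nonneg:
  assumes z: "z \<in> ball 0 1"
  shows "0 \<le> garsia_Phi f z"
proof -
  interpret Q: prob_space "harmonic_measure z"
    by (rule prob_space_harmonic_measure[OF z])
  have "0 \<le> Q.expectation (\<lambda>\<zeta>. (norm (f \<zeta> - integral\<^sup>L (harmonic_measure z) f))\<^sup>2)"
    by simp
  also have "\<dots> = garsia_Phi f z"
    using z AE_harmonic_measure[OF bound]
    by (subst Q.complex_variance_eq) (auto simp: garsia_Phi_def poisson_eq_harmonic_integral)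
  finally show ?thesis .
qed

text \<open>
  Where the variance of \<open>f\<close> is small, \<open>f\<close> is nearly the constant \<open>poisson f z\<close> for harmonic measure, so
  the Poisson integral at \<open>z\<close> of a product with a bounded factor nearly splits.
\<close>

lemma norm_poisson_mult_diff_le:
  assumes z: "z \<in> ball 0 1" and [measurable]: "u \<in> borel_measurable circle_measure"
    and u: "AE \<zeta> in circle_measure. norm (u \<zeta>) \<le> 1"
  shows "norm (poisson (\<lambda>\<zeta>. u \<zeta> * f \<zeta>) z - poisson u z * poisson f z) \<le> sqrt (garsia_Phi f z)"
proof -
  interpret Q: prob_space "harmonic_measure z"
    by (rule prob_space_harmonic_measure[OF z])
  show ?thesis
    using Q.norm_expectation_mult_diff_le[OF _ _ AE_harmonic_measure[OF u] AE_harmonic_measure[OF bound]] z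
    by (simp add: garsia_Phi_def poisson_eq_harmonic_integral)
qed

text \<open>
  Harnack's inequality at the origin for the nonnegative harmonic function \<open>\<P>(M\<^sup>2 - |f|\<^sup>2)\<close>, with the
  factor \<open>1 + |z|\<close> bounded by \<open>2\<close>: if \<open>\<P>(|f|\<^sup>2)(z)\<close> is close to \<open>M\<^sup>2\<close>, then either \<open>z\<close> is close to the
  circle or \<open>|f|\<close> is close to \<open>M\<close> in the mean.
\<close>

lemma harnack_deficit:
  assumes z: "z \<in> ball 0 1"
  shows "(1 - norm z) * (\<integral>\<zeta>. M\<^sup>2 - (norm (f \<zeta>))\<^sup>2 \<partial>circle_measure)
           \<le> 2 * (M\<^sup>2 - poisson (\<lambda>\<zeta>. (norm (f \<zeta>))\<^sup>2) z)"
proof -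
  interpret Q: prob_space "harmonic_measure z"
    by (rule prob_space_harmonic_measure[OF z])
  define g where "g = (\<lambda>\<zeta>. M\<^sup>2 - (norm (f \<zeta>))\<^sup>2)"
  have gm [measurable]: "g \<in> borel_measurable circle_measure"
    unfolding g_def by measurable
  have g0: "AE \<zeta> in circle_measure. 0 \<le> g \<zeta>"
    using bound by eventually_elim (auto simp: g_def intro!: power_mono)
  have f2: "integrable (harmonic_measure z) (\<lambda>\<zeta>. (norm (f \<zeta>))\<^sup>2)"
    using AE_harmonic_measure[OF bound] by (intro Q.integrable_bounded_power2) auto
  then have Qg: "integrable (harmonic_measure z) g"
    unfolding g_def by simp
  have cg: "integrable circle_measure g"
    unfolding g_def using circle.integrable_bounded_power2[OF meas bound] by simp
  have kg: "integrable circle_measure (\<lambda>\<zeta>. poisson_kernel z \<zeta> * g \<zeta>)"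
    using Qg poisson_kernel_nonneg[OF z]
    unfolding harmonic_measure_def by (subst (asm) integrable_density) auto
  have ker: "1 - norm z \<le> 2 * poisson_kernel z \<zeta>" if "\<zeta> \<in> sphere 0 1" for \<zeta>
  proof -
    have ne: "norm (\<zeta> - z) > 0"
      using that z by auto
    have "norm (\<zeta> - z) \<le> 1 + norm z"
      using norm_triangle_ineq4[of \<zeta> z] that by simp
    then have "(norm (\<zeta> - z))\<^sup>2 \<le> (1 + norm z)\<^sup>2"
      by (intro power_mono) auto
    also have "\<dots> \<le> 2 * (1 + norm z)"
      unfolding power2_eq_square using z by (intro mult_right_mono) auto
    finally have "(1 - norm z) * (norm (\<zeta> - z))\<^sup>2 \<le> (1 - norm z) * (2 * (1 + norm z))"
      using z by (intro mult_left_mono) auto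
    \<comment> \<open>The right-hand side is \<open>2 (1 - |z|\<^sup>2)\<close>, twice the numerator of the kernel.\<close>
    then show ?thesis
      using ne by (simp add: poisson_kernel_def field_simps power2_eq_square)
  qed
  have "(1 - norm z) * integral\<^sup>L circle_measure g = (\<integral>\<zeta>. (1 - norm z) * g \<zeta> \<partial>circle_measure)"
    using cg by simp
  also have "\<dots> \<le> (\<integral>\<zeta>. 2 * (poisson_kernel z \<zeta> * g \<zeta>) \<partial>circle_measure)"
  proof (rule integral_mono_AE)
    show "AE \<zeta> in circle_measure. (1 - norm z) * g \<zeta> \<le> 2 * (poisson_kernel z \<zeta> * g \<zeta>)"
      using g0 AE_space
    proof eventually_elim
      case (elim \<zeta>)
      then show ?case
        using mult_right_mono[OF ker, of \<zeta> "g \<zeta>"] by (simp add: space_circle_measure mult.assoc)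
    qed
  qed (use cg kg in auto)
  also have "\<dots> = 2 * integral\<^sup>L (harmonic_measure z) g"
    using poisson_eq_harmonic_integral[OF gm z] kg
    by (simp add: poisson_def poisson_kernel_def[symmetric])
  also have "\<dots> = 2 * (M\<^sup>2 - poisson (\<lambda>\<zeta>. (norm (f \<zeta>))\<^sup>2) z)"
    using z f2 by (simp add: g_def poisson_eq_harmonic_integral Q.prob_space)
  finally show ?thesis
    by (simp add: g_def)
qed

lemma AE_norm_eq_if_deficit_zero:
  assumes "(\<integral>\<zeta>. M\<^sup>2 - (norm (f \<zeta>))\<^sup>2 \<partial>circle_measure) = 0" and "0 \<le> M"
  shows "AE \<zeta> in circle_measure. norm (f \<zeta>) = M"
proof -
  have "AE \<zeta> in circle_measure. M\<^sup>2 - (norm (f \<zeta>))\<^sup>2 = 0"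
  proof (subst integral_nonneg_eq_0_iff_AE[symmetric])
    show "AE \<zeta> in circle_measure. 0 \<le> M\<^sup>2 - (norm (f \<zeta>))\<^sup>2"
      using bound by eventually_elim (auto intro!: power_mono)
  qed (use assms circle.integrable_bounded_power2[OF meas bound] in auto)
  then show ?thesis
    by eventually_elim (use assms(2) in \<open>auto intro: power2_eq_imp_eq\<close>)
qed

end

lemma poisson_power2_cong:
  assumes [measurable]: "f \<in> borel_measurable circle_measure" "g \<in> borel_measurable circle_measure"
    and "AE \<zeta> in circle_measure. norm (f \<zeta>) = norm (g \<zeta>)"
  shows "poisson (\<lambda>\<zeta>. (norm (f \<zeta>))\<^sup>2) z = poisson (\<lambda>\<zeta>. (norm (g \<zeta>))\<^sup>2) z"
  unfolding poisson_def poisson_kernel_def[symmetric]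
proof (rule integral_cong_AE)
  show "AE \<zeta> in circle_measure. poisson_kernel z \<zeta> *\<^sub>R (norm (f \<zeta>))\<^sup>2 = poisson_kernel z \<zeta> *\<^sub>R (norm (g \<zeta>))\<^sup>2"
    using assms(3) by eventually_elim simp
qed auto

lemma poisson_power2_const:
  assumes [measurable]: "f \<in> borel_measurable circle_measure"
    and "AE \<zeta> in circle_measure. norm (f \<zeta>) = M" and z: "z \<in> ball 0 1"
  shows "poisson (\<lambda>\<zeta>. (norm (f \<zeta>))\<^sup>2) z = M\<^sup>2"
proof -
  interpret Q: prob_space "harmonic_measure z"
    by (rule prob_space_harmonic_measure[OF z])
  have "AE \<zeta> in harmonic_measure z. (norm (f \<zeta>))\<^sup>2 = M\<^sup>2"
    using AE_harmonic_measure[OF assms(2)] by eventually_elim simp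
  then have "Q.expectation (\<lambda>\<zeta>. (norm (f \<zeta>))\<^sup>2) = Q.expectation (\<lambda>_. M\<^sup>2)"
    by (intro integral_cong_AE) auto
  then show ?thesis
    using z by (simp add: poisson_eq_harmonic_integral Q.prob_space)
qed

section \<open>Constant boundary modulus\<close>

text \<open>
  The minimum principle for zero-free functions: for every \<open>b < c\<close>, the function \<open>1/g\<close> is bounded by
  \<open>1/b\<close> on circles close to the boundary, hence inside them.
\<close>

lemma holomorphic_norm_ge_if_boundary_norm_ge:
  fixes g :: "complex \<Rightarrow> complex"
  assumes hol: "g holomorphic_on ball 0 1" and nz: "\<And>w. w \<in> ball 0 1 \<Longrightarrow> g w \<noteq> 0"
    and lim: "((\<lambda>w. norm (g w)) \<longlongrightarrow> c) (filtercomap norm (at_left 1))"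
    and z: "z \<in> ball 0 1"
  shows "c \<le> norm (g z)"
proof (rule ccontr)
  assume "\<not> c \<le> norm (g z)"
  then obtain b where b: "norm (g z) < b" "b < c"
    using dense by (auto simp: not_le)
  have b0: "0 < b"
    using b(1) norm_ge_zero le_less_trans by blast
  from order_tendstoD(1)[OF lim b(2)]
  obtain P where P: "eventually P (at_left 1)" "\<And>w. P (norm w) \<Longrightarrow> b < norm (g w)"
    unfolding eventually_filtercomap by blast
  from P(1) obtain s where s: "s < 1" "\<And>r. s < r \<Longrightarrow> r < 1 \<Longrightarrow> P r"
    unfolding eventually_at_left_field by blast
  obtain r where r: "max s (norm z) < r" "r < 1"
    using s(1) z dense[of "max s (norm z)" 1] by auto
  have r0: "0 < r"
    using r(1) norm_ge_zero[of z] by linarith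
  have sub: "cball 0 r \<subseteq> ball (0::complex) 1"
    using r(2) by auto
  have inv: "(\<lambda>w. inverse (g w)) holomorphic_on ball 0 1"
    using hol nz by (intro holomorphic_intros) auto
  have "norm (inverse (g z)) \<le> inverse b"
  proof (rule maximum_modulus_frontier[where S = "cball 0 r" and f = "\<lambda>w. inverse (g w)" and \<xi> = z])
    show "(\<lambda>w. inverse (g w)) holomorphic_on interior (cball 0 r)"
      using inv sub by (rule holomorphic_on_subset[OF _ order_trans[OF interior_subset]])
    show "continuous_on (closure (cball 0 r)) (\<lambda>w. inverse (g w))"
      using holomorphic_on_imp_continuous_on[OF inv] sub by (auto intro: continuous_on_subset)
    fix w :: complex assume "w \<in> frontier (cball 0 r)"
    then have "norm w = r"
      using r0 by (simp add: frontier_cball)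
    then have "b < norm (g w)"
      using P(2) s(2) r by auto
    then show "norm (inverse (g w)) \<le> inverse b"
      using b0 by (simp add: norm_inverse le_imp_inverse_le)
  qed (use r in auto)
  then have "b \<le> norm (g z)"
    using b0 nz[OF z] by (simp add: norm_inverse)
  then show False
    using b(1) by simp
qed

text \<open>
  Here \<open>\<Phi>\<^sub>f = M\<^sup>2 - |\<P>f|\<^sup>2\<close>, so vanishing mean oscillation makes \<open>|\<P>f|\<close> tend to \<open>M\<close> at the boundary, and
  the minimum principle leaves no room for \<open>|\<P>f| < M\<close> inside.
\<close>

lemma garsia_Phi_zero_if_norm_const:
  assumes [measurable]: "f \<in> borel_measurable circle_measure"
    and eq: "AE \<zeta> in circle_measure. norm (f \<zeta>) = M" and M: "0 \<le> M"
    and an: "poisson f analytic_on ball 0 1" and nz: "\<And>w. w \<in> ball 0 1 \<Longrightarrow> poisson f w \<noteq> 0"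
    and vmo: "(garsia_Phi f \<longlongrightarrow> 0) (filtercomap norm (at_left 1))"
    and z: "z \<in> ball 0 1"
  shows "garsia_Phi f z = 0"
proof -
  have bound: "AE \<zeta> in circle_measure. norm (f \<zeta>) \<le> M"
    using eq by eventually_elim simp
  have Phi: "garsia_Phi f w = M\<^sup>2 - (norm (poisson f w))\<^sup>2" if "w \<in> ball 0 1" for w
    using poisson_power2_const[OF assms(1) eq that] by (simp add: garsia_Phi_def)
  have "((\<lambda>w. sqrt (M\<^sup>2 - garsia_Phi f w)) \<longlongrightarrow> sqrt (M\<^sup>2 - 0)) (filtercomap norm (at_left 1))"
    by (intro tendsto_intros vmo)
  moreover have "eventually (\<lambda>w. sqrt (M\<^sup>2 - garsia_Phi f w) = norm (poisson f w))
      (filtercomap norm (at_left 1))"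
  proof -
    have "eventually (\<lambda>w::complex. norm w < 1) (filtercomap norm (at_left 1))"
      by (intro eventually_filtercomapI) (simp add: eventually_at_filter)
    then show ?thesis
      by eventually_elim (simp add: Phi)
  qed
  ultimately have "((\<lambda>w. norm (poisson f w)) \<longlongrightarrow> sqrt (M\<^sup>2 - 0)) (filtercomap norm (at_left 1))"
    by (rule Lim_transform_eventually)
  then have "((\<lambda>w. norm (poisson f w)) \<longlongrightarrow> M) (filtercomap norm (at_left 1))"
    using M by simp
  from holomorphic_norm_ge_if_boundary_norm_ge[OF analytic_imp_holomorphic[OF an] nz this z]
  have "M\<^sup>2 \<le> (norm (poisson f z))\<^sup>2"
    using M by (intro power_mono) auto
  then show ?thesis
    using Phi[OF z] garsia_Phi_nonneg[OF assms(1) bound z] by simp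
qed

section \<open>Extremality in terms of sequences\<close>

lemma Linf_bound:
  assumes "f \<in> Linf"
  obtains M where "0 \<le> M" "linf_norm f = ennreal M" "AE \<zeta> in circle_measure. norm (f \<zeta>) \<le> M"
proof -
  obtain M where M: "0 \<le> M" "linf_norm f = ennreal M"
    using assms by (cases "linf_norm f") (auto simp: Linf_def)
  have "AE \<zeta> in circle_measure. ennreal (norm (f \<zeta>)) \<le> linf_norm f"
    unfolding linf_norm_def by (rule esssup_AE)
  then have "AE \<zeta> in circle_measure. norm (f \<zeta>) \<le> M"
    by eventually_elim (use M in simp)
  with M show thesis
    by (rule that)
qed

text \<open>
  The supremum that defines the Garsia norm is approximated by a sequence, whether or not it is attained.
\<close>

lemma garsia_norm_eq_iff_sequence:
  assumes M: "0 \<le> M" and le: "\<And>z. z \<in> ball 0 1 \<Longrightarrow> garsia_Phi f z \<le> M\<^sup>2"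
    and nonneg: "\<And>z. z \<in> ball 0 1 \<Longrightarrow> 0 \<le> garsia_Phi f z"
  shows "garsia_norm f = ennreal M \<longleftrightarrow>
    (\<exists>z :: nat \<Rightarrow> complex. (\<forall>n. z n \<in> ball 0 1) \<and> (\<lambda>n. garsia_Phi f (z n)) \<longlonglongrightarrow> M\<^sup>2)"
proof
  assume eq: "garsia_norm f = ennreal M"
  have "\<exists>z\<in>ball 0 1. M - 1 / Suc n \<le> sqrt (garsia_Phi f z)" for n
  proof (rule ccontr)
    assume "\<not> ?thesis"
    then have *: "sqrt (garsia_Phi f z) < M - 1 / Suc n" if "z \<in> ball 0 1" for z
      using that by (meson not_le)
    have "0 \<le> sqrt (garsia_Phi f 0)"
      using nonneg[of 0] by simp
    also have "\<dots> < M - 1 / Suc n"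
      by (rule *) simp
    finally have pos: "0 < M - 1 / Suc n" .
    have "garsia_norm f \<le> ennreal (M - 1 / Suc n)"
      unfolding garsia_norm_def using * by (intro SUP_least ennreal_leI) (auto intro: less_imp_le)
    then have "M \<le> M - 1 / Suc n"
      unfolding eq using pos by (subst (asm) ennreal_le_iff) auto
    then show False
      by simp
  qed
  then obtain z where z: "\<And>n. z n \<in> ball 0 1" "\<And>n. M - 1 / Suc n \<le> sqrt (garsia_Phi f (z n))"
    by metis
  have "sqrt (garsia_Phi f (z n)) \<le> M" for n
    using le[OF z(1)] M by (intro real_le_lsqrt) auto
  then have "(\<lambda>n. sqrt (garsia_Phi f (z n))) \<longlonglongrightarrow> M"
    using z(2) tendsto_diff[OF tendsto_const[of M] LIMSEQ_Suc[OF lim_1_over_n]]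
    by - (rule tendsto_sandwich[where f = "\<lambda>n. M - 1 / Suc n" and h = "\<lambda>_. M"], auto)
  then have "(\<lambda>n. (sqrt (garsia_Phi f (z n)))\<^sup>2) \<longlonglongrightarrow> M\<^sup>2"
    by (rule tendsto_power)
  then show "\<exists>z :: nat \<Rightarrow> complex. (\<forall>n. z n \<in> ball 0 1) \<and> (\<lambda>n. garsia_Phi f (z n)) \<longlonglongrightarrow> M\<^sup>2"
    using z(1) nonneg by auto
next
  assume "\<exists>z :: nat \<Rightarrow> complex. (\<forall>n. z n \<in> ball 0 1) \<and> (\<lambda>n. garsia_Phi f (z n)) \<longlonglongrightarrow> M\<^sup>2"
  then obtain z :: "nat \<Rightarrow> complex"
    where z: "\<And>n. z n \<in> ball 0 1" "(\<lambda>n. garsia_Phi f (z n)) \<longlonglongrightarrow> M\<^sup>2"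
    by auto
  have "(\<lambda>n. ennreal (sqrt (garsia_Phi f (z n)))) \<longlonglongrightarrow> ennreal (sqrt (M\<^sup>2))"
    by (intro tendsto_intros z(2))
  moreover have "ennreal (sqrt (garsia_Phi f (z n))) \<le> garsia_norm f" for n
    unfolding garsia_norm_def by (intro SUP_upper z(1))
  ultimately have "ennreal M \<le> garsia_norm f"
    using M by (intro LIMSEQ_le_const2) auto
  moreover have "garsia_norm f \<le> ennreal M"
    unfolding garsia_norm_def using le M by (intro SUP_least ennreal_leI real_le_lsqrt) auto
  ultimately show "garsia_norm f = ennreal M"
    by simp
qed

text \<open>
  The sequence need not approach the circle: the mean \<open>c\<close> of \<open>M\<^sup>2 - |f|\<^sup>2\<close> decides. If \<open>c > 0\<close>, Harnack's
  inequality pushes the sequence to the circle, where vanishing mean oscillation applies; if \<open>c = 0\<close>,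
  then \<open>|f| = M\<close> almost everywhere and \<open>\<Phi>\<^sub>f\<close> vanishes on the whole disc.
\<close>

lemma garsia_Phi_tendsto_zero_if_power2_tendsto:
  assumes meas: "f \<in> borel_measurable circle_measure"
    and bound: "AE \<zeta> in circle_measure. norm (f \<zeta>) \<le> M" and M: "0 \<le> M"
    and an: "poisson f analytic_on ball 0 1" and nz: "\<And>w. w \<in> ball 0 1 \<Longrightarrow> poisson f w \<noteq> 0"
    and vmo: "(garsia_Phi f \<longlongrightarrow> 0) (filtercomap norm (at_left 1))"
    and z: "\<And>n::nat. z n \<in> ball 0 1"
    and lim: "(\<lambda>n. poisson (\<lambda>\<zeta>. (norm (f \<zeta>))\<^sup>2) (z n)) \<longlonglongrightarrow> M\<^sup>2"
  shows "(\<lambda>n. garsia_Phi f (z n)) \<longlonglongrightarrow> 0"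
proof -
  define c where "c = (\<integral>\<zeta>. M\<^sup>2 - (norm (f \<zeta>))\<^sup>2 \<partial>circle_measure)"
  have "0 \<le> c"
    unfolding c_def
  proof (rule integral_nonneg_AE)
    show "AE \<zeta> in circle_measure. 0 \<le> M\<^sup>2 - (norm (f \<zeta>))\<^sup>2"
      using bound by eventually_elim (auto intro!: power_mono)
  qed
  then consider "c = 0" | "0 < c"
    by linarith
  then show ?thesis
  proof cases
    case 1
    then have "AE \<zeta> in circle_measure. norm (f \<zeta>) = M"
      using AE_norm_eq_if_deficit_zero[OF meas bound] M by (simp add: c_def)
    from garsia_Phi_zero_if_norm_const[OF meas this M an nz vmo z] show ?thesis
      by simp
  next
    case 2
    define d where "d = (\<lambda>n. 2 * (M\<^sup>2 - poisson (\<lambda>\<zeta>. (norm (f \<zeta>))\<^sup>2) (z n)) / c)"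
    have "1 - d n \<le> norm (z n)" for n
      using harnack_deficit[OF meas bound z[of n]] 2 by (simp add: c_def d_def field_simps)
    moreover have "norm (z n) \<le> 1" for n
      using z[of n] by simp
    moreover have "(\<lambda>n. 1 - d n) \<longlonglongrightarrow> 1 - 2 * (M\<^sup>2 - M\<^sup>2) / c"
      unfolding d_def by (intro tendsto_intros lim) (use 2 in auto)
    ultimately have "(\<lambda>n. norm (z n)) \<longlonglongrightarrow> 1"
      by - (rule tendsto_sandwich[where f = "\<lambda>n. 1 - d n" and h = "\<lambda>_. 1"], auto)
    then have "filterlim (\<lambda>n. norm (z n)) (at_left 1) sequentially"
      using z by (auto simp: filterlim_at less_imp_neq)
    then have "filterlim z (filtercomap norm (at_left 1)) sequentially"
      by (simp add: filterlim_filtercomap_iff o_def)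
    then show ?thesis
      by (rule filterlim_compose[OF vmo])
  qed
qed

theorem theorem2p5:
  fixes F I :: "complex \<Rightarrow> complex"
  assumes "F \<in> QA" and "outer_function (poisson F)" and "inner_function I"
  shows "G_extremal (\<lambda>\<zeta>. I \<zeta> * F \<zeta>) \<longleftrightarrow>
    (\<exists>z :: nat \<Rightarrow> complex. (\<forall>n. z n \<in> ball 0 1) \<and>
       (\<lambda>n. ennreal (norm (poisson F (z n)))) \<longlonglongrightarrow> linf_norm F \<and>
       (\<lambda>n. poisson I (z n)) \<longlonglongrightarrow> 0)"
proof -
  have Fm [measurable]: "F \<in> borel_measurable circle_measure" and F: "F \<in> Linf"
    and an: "poisson F analytic_on ball 0 1"
    and vmo: "(garsia_Phi F \<longlongrightarrow> 0) (filtercomap norm (at_left 1))"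
    using assms(1) by (auto simp: QA_def VMO_def Hinf_def Linf_def)
  have nz: "poisson F w \<noteq> 0" if "w \<in> ball 0 1" for w
    using assms(2) that by (auto simp: outer_function_def)
  have Im [measurable]: "I \<in> borel_measurable circle_measure"
    and I1: "AE \<zeta> in circle_measure. norm (I \<zeta>) = 1"
    using assms(3) by (auto simp: inner_function_def Hinf_def Linf_def)
  have I1': "AE \<zeta> in circle_measure. norm (I \<zeta>) \<le> 1"
    using I1 by eventually_elim simp
  obtain M where M0: "0 \<le> M" and M: "linf_norm F = ennreal M"
    and FM: "AE \<zeta> in circle_measure. norm (F \<zeta>) \<le> M"
    using Linf_bound[OF F] by blast
  define G where "G = (\<lambda>\<zeta>. I \<zeta> * F \<zeta>)"
  have Gm [measurable]: "G \<in> borel_measurable circle_measure"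
    unfolding G_def by measurable
  have GF: "AE \<zeta> in circle_measure. norm (G \<zeta>) = norm (F \<zeta>)"
    using I1 by eventually_elim (simp add: G_def norm_mult)
  have GM: "AE \<zeta> in circle_measure. norm (G \<zeta>) \<le> M"
    using GF FM by eventually_elim simp
  have "linf_norm G = linf_norm F"
    unfolding linf_norm_def
  proof (rule esssup_AE_cong)
    show "AE \<zeta> in circle_measure. ennreal (norm (G \<zeta>)) = ennreal (norm (F \<zeta>))"
      using GF by eventually_elim simp
  qed auto
  then have ext: "G_extremal G \<longleftrightarrow> garsia_norm G = ennreal M"
    using Gm by (simp add: G_extremal_def Linf_def M)
  have PhiG: "garsia_Phi G z = poisson (\<lambda>\<zeta>. (norm (F \<zeta>))\<^sup>2) z - (norm (poisson G z))\<^sup>2" for z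
    using poisson_power2_cong[OF Gm Fm GF] by (simp add: garsia_Phi_def)
  have PF_le: "poisson (\<lambda>\<zeta>. (norm (F \<zeta>))\<^sup>2) z \<le> M\<^sup>2" if "z \<in> ball 0 1" for z
    by (rule poisson_power2_le[OF Fm FM that])
  have PF_ge: "(norm (poisson F z))\<^sup>2 \<le> poisson (\<lambda>\<zeta>. (norm (F \<zeta>))\<^sup>2) z" if "z \<in> ball 0 1" for z
    using garsia_Phi_nonneg[OF Fm FM that] by (simp add: garsia_Phi_def)
  have mult: "norm (poisson G z - poisson I z * poisson F z) \<le> sqrt (garsia_Phi F z)"
    if "z \<in> ball 0 1" for z
    unfolding G_def by (rule norm_poisson_mult_diff_le[OF Fm FM that Im I1'])
  \<comment> \<open>Positivity of \<open>M\<close> allows dividing \<open>I(z\<^sub>n) F(z\<^sub>n) \<rightarrow> 0\<close> by \<open>|F(z\<^sub>n)| \<rightarrow> M\<close>.\<close>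
  have M_pos: "0 < M"
  proof -
    have "0 < norm (poisson F 0)"
      using nz[of 0] by simp
    also have "norm (poisson F 0) \<le> M"
      using order_trans[OF PF_ge PF_le, of 0] M0 by (intro power2_le_imp_le[of "norm (poisson F 0)" M]) simp_all
    finally show ?thesis .
  qed
  have key: "(\<lambda>n. garsia_Phi G (z n)) \<longlonglongrightarrow> M\<^sup>2 \<longleftrightarrow>
      (\<lambda>n. norm (poisson F (z n))) \<longlonglongrightarrow> M \<and> (\<lambda>n. poisson I (z n)) \<longlonglongrightarrow> 0"
    if z: "\<And>n::nat. z n \<in> ball 0 1" for z
  proof
    assume L: "(\<lambda>n. garsia_Phi G (z n)) \<longlonglongrightarrow> M\<^sup>2"
    \<comment> \<open>The second moment lies between \<open>\<Phi>\<^bsub>IF\<^esub>\<close> and \<open>M\<^sup>2\<close>.\<close>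
    have P: "(\<lambda>n. poisson (\<lambda>\<zeta>. (norm (F \<zeta>))\<^sup>2) (z n)) \<longlonglongrightarrow> M\<^sup>2"
      by (rule tendsto_sandwich[OF _ _ L tendsto_const]) (auto simp: PhiG intro!: always_eventually PF_le[OF z])
    have Phi: "(\<lambda>n. garsia_Phi F (z n)) \<longlonglongrightarrow> 0"
      by (rule garsia_Phi_tendsto_zero_if_power2_tendsto[OF Fm FM M0 an nz vmo z P])
    have "(\<lambda>n. sqrt (poisson (\<lambda>\<zeta>. (norm (F \<zeta>))\<^sup>2) (z n) - garsia_Phi F (z n))) \<longlonglongrightarrow> sqrt (M\<^sup>2 - 0)"
      by (intro tendsto_intros P Phi)
    then have F_lim: "(\<lambda>n. norm (poisson F (z n))) \<longlonglongrightarrow> M"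
      using M0 by (simp add: garsia_Phi_def)
    have "(\<lambda>n. sqrt (poisson (\<lambda>\<zeta>. (norm (F \<zeta>))\<^sup>2) (z n) - garsia_Phi G (z n))) \<longlonglongrightarrow> sqrt (M\<^sup>2 - M\<^sup>2)"
      by (intro tendsto_intros P L)
    then have "(\<lambda>n. poisson G (z n)) \<longlonglongrightarrow> 0"
      by (simp add: PhiG tendsto_norm_zero_iff)
    moreover have "(\<lambda>n. poisson G (z n) - poisson I (z n) * poisson F (z n)) \<longlonglongrightarrow> 0"
      using tendsto_real_sqrt[OF Phi] mult[OF z]
      by - (rule Lim_null_comparison[where g = "\<lambda>n. sqrt (garsia_Phi F (z n))"], auto)
    ultimately have "(\<lambda>n. poisson G (z n) - (poisson G (z n) - poisson I (z n) * poisson F (z n))) \<longlonglongrightarrow> 0 - 0"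
      by (rule tendsto_diff)
    then have "(\<lambda>n. poisson I (z n) * poisson F (z n)) \<longlonglongrightarrow> 0"
      by simp
    then have "(\<lambda>n. norm (poisson I (z n) * poisson F (z n))) \<longlonglongrightarrow> 0"
      by (rule tendsto_norm_zero)
    from tendsto_divide[OF this F_lim] have "(\<lambda>n. norm (poisson I (z n))) \<longlonglongrightarrow> 0"
      using M_pos nz[OF z] by (simp add: norm_mult)
    with F_lim show "(\<lambda>n. norm (poisson F (z n))) \<longlonglongrightarrow> M \<and> (\<lambda>n. poisson I (z n)) \<longlonglongrightarrow> 0"
      by (simp add: tendsto_norm_zero_iff)
  next
    assume "(\<lambda>n. norm (poisson F (z n))) \<longlonglongrightarrow> M \<and> (\<lambda>n. poisson I (z n)) \<longlonglongrightarrow> 0"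
    then have F_lim: "(\<lambda>n. norm (poisson F (z n))) \<longlonglongrightarrow> M"
      and I_lim: "(\<lambda>n. norm (poisson I (z n))) \<longlonglongrightarrow> 0"
      by (auto simp: tendsto_norm_zero_iff)
    \<comment> \<open>The second moment lies between \<open>|\<P>F|\<^sup>2\<close> and \<open>M\<^sup>2\<close>.\<close>
    have P: "(\<lambda>n. poisson (\<lambda>\<zeta>. (norm (F \<zeta>))\<^sup>2) (z n)) \<longlonglongrightarrow> M\<^sup>2"
      by (rule tendsto_sandwich[OF _ _ tendsto_power[OF F_lim] tendsto_const])
         (auto intro!: always_eventually PF_le[OF z] PF_ge[OF z])
    from tendsto_diff[OF P tendsto_power[OF F_lim, of 2]]
    have "(\<lambda>n. garsia_Phi F (z n)) \<longlonglongrightarrow> 0"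
      by (simp add: garsia_Phi_def)
    from tendsto_add[OF tendsto_real_sqrt[OF this] tendsto_mult[OF I_lim F_lim]]
    have "(\<lambda>n. sqrt (garsia_Phi F (z n)) + norm (poisson I (z n)) * norm (poisson F (z n))) \<longlonglongrightarrow> 0"
      by simp
    moreover have "norm (poisson G (z n))
        \<le> sqrt (garsia_Phi F (z n)) + norm (poisson I (z n)) * norm (poisson F (z n))" for n
      using mult[OF z[of n]] norm_triangle_sub[of "poisson G (z n)" "poisson I (z n) * poisson F (z n)"]
      by (simp add: norm_mult)
    ultimately have "(\<lambda>n. poisson G (z n)) \<longlonglongrightarrow> 0"
      by - (rule Lim_null_comparison[OF always_eventually], auto)
    from tendsto_diff[OF P tendsto_power[OF tendsto_norm[OF this], of 2]]
    show "(\<lambda>n. garsia_Phi G (z n)) \<longlonglongrightarrow> M\<^sup>2"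
      by (simp add: PhiG)
  qed
  have "garsia_norm G = ennreal M \<longleftrightarrow>
      (\<exists>z :: nat \<Rightarrow> complex. (\<forall>n. z n \<in> ball 0 1) \<and> (\<lambda>n. garsia_Phi G (z n)) \<longlonglongrightarrow> M\<^sup>2)"
  proof (rule garsia_norm_eq_iff_sequence[OF M0])
    fix z :: complex assume z: "z \<in> ball 0 1"
    show "garsia_Phi G z \<le> M\<^sup>2"
      unfolding PhiG by (rule order_trans[OF _ PF_le[OF z]]) simp
    show "0 \<le> garsia_Phi G z"
      by (rule garsia_Phi_nonneg[OF Gm GM z])
  qed
  then show ?thesis
    unfolding G_def[symmetric] ext M using key M0 by (auto simp: tendsto_ennreal_iff)
qed

end
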